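(* Let $(X,\mathscr{E})$ be a coarse space with coarse property A and let $x_0\in X$ be a basepoint. Then the coarse free product $(\ast X,\ast\mathscr{E})$ has coarse property A.
   Context: Coarse spaces. For $E,F\subset X\times X$ put $E\circ F=\{(x,z): \exists y,\ (x,y)\in E,\ (y,z)\in F\}$, $E^{-1}=\{(y,x):(x,y)\in E\}$, and let $\Delta$ be the diagonal. A coarse structure on $X$ is a collection $\mathscr{E}$ of subsets of $X\times X$ (called entourages) containing $\Delta$ and closed under inverses, finite unions, subsets and compositions; $(X,\mathscr{E})$ is then a coarse space. Coarse property A. $(X,\mathscr{E})$ has coarse property A if for every $\varepsilon>0$ and every $E\in\mathscr{E}$ there are an entourage $K\in\mathscr{E}$ and a map $x\mapsto a_x$ from $X$ to $\ell^1(X)$ such that $a_x\ge 0$ and $\|a_x\|_1=1$ for all $x$; $a_x$ is supported in $\{y:(x,y)\in K\}$ for all $x$; and $\|a_x-a_y\|_1<\varepsilon$ whenever $(x,y)\in E$. Coarse free product. $\ast X$ is the set of finite words in the alphabet $X\setminus\{x_0\}$, including the empty word $\boldsymbol{\epsilon}$, which is identified with $x_0$. For $E\in\mathscr{E}$ let $E^k$ be the $k$-fold composition ($k\ge1$), $E^0=E\cap\Delta$, and $D_E(x,y)=\min\{k\ge 0:(x,y)\in E^k\}\in\mathbb{Z}_{\ge0}\cup\{+\infty\}$ ($\min\emptyset=+\infty$). For $\mathbf{x}=x_1\cdots x_k\in\ast X$ put $\|\mathbf{x}\|_E=\sum_i D_E(x_0,x_i)$, $\|\mathbf{x}\|^E=\sum_i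 D_E(x_i,x_0)$, and $\|\boldsymbol{\epsilon}\|_E=\|\boldsymbol{\epsilon}\|^E=0$. Distinct words are written uniquely as $\mathbf{x}=\mathbf{a}b\mathbf{c}$, $\mathbf{x}'=\mathbf{a}b'\mathbf{c}'$, where $\mathbf{a}$ is their longest common prefix and $b\ne b'$ are the next letters (if $\mathbf{x}=\mathbf{a}$ then $b=x_0$, $\mathbf{c}=\boldsymbol{\epsilon}$; similarly for $\mathbf{x}'$). Put $D^*_E(\mathbf{x},\mathbf{x})=0$ and $D_E^*(\mathbf{x},\mathbf{x}')=D_E(b,b')+\|\mathbf{c}\|_E+\|\mathbf{c}'\|^E$ for $\mathbf{x}\ne\mathbf{x}'$. Let $\langle E,n\rangle=\{(\mathbf{x},\mathbf{x}'): D_E^*(\mathbf{x},\mathbf{x}')\le n\}$. The coarse structure $\ast\mathscr{E}$ consists of all subsets of the sets $\langle E,n\rangle$, $E\in\mathscr{E}$, $n\in\mathbb{N}$. *)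

theory Defs
  imports "HOL-Analysis.Infinite_Sum" "HOL-Library.Extended_Nat" "HOL-Library.Sublist"
begin

locale coarse_space =
  fixes X :: "'a set" and \<E> :: "('a \<times> 'a) set set"
  assumes subset_carrier: "E \<in> \<E> \<Longrightarrow> E \<subseteq> X \<times> X"
    and diagonal: "Id_on X \<in> \<E>"
    and inverse: "E \<in> \<E> \<Longrightarrow> E\<inverse> \<in> \<E>"
    and union: "E \<in> \<E> \<Longrightarrow> F \<in> \<E> \<Longrightarrow> E \<union> F \<in> \<E>"
    and subset: "E \<in> \<E> \<Longrightarrow> F \<subseteq> E \<Longrightarrow> F \<in> \<E>"
    and composition: "E \<in> \<E> \<Longrightarrow> F \<in> \<E> \<Longrightarrow> E O F \<in> \<E>"

(* Elements of l^1(X) are represented by real functions on the ambient type; only their values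
   on X matter. *)

definition l1 :: "'a set \<Rightarrow> ('a \<Rightarrow> real) set" where
  "l1 X = {f. (\<lambda>y. \<bar>f y\<bar>) summable_on X}"

definition l1_norm :: "'a set \<Rightarrow> ('a \<Rightarrow> real) \<Rightarrow> real" where
  "l1_norm X f = (\<Sum>\<^sub>\<infinity>y\<in>X. \<bar>f y\<bar>)"

definition coarse_property_A :: "'a set \<Rightarrow> ('a \<times> 'a) set set \<Rightarrow> bool" where
  "coarse_property_A X \<E> \<longleftrightarrow>
     (\<forall>\<epsilon>>0. \<forall>E\<in>\<E>. \<exists>K\<in>\<E>. \<exists>a :: 'a \<Rightarrow> 'a \<Rightarrow> real.
        (\<forall>x\<in>X. a x \<in> l1 X \<and> (\<forall>y\<in>X. 0 \<le> a x y) \<and> l1_norm X (a x) = 1) \<and>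
        (\<forall>x\<in>X. \<forall>y\<in>X. a x y \<noteq> 0 \<longrightarrow> (x, y) \<in> K) \<and>
        (\<forall>(x, y)\<in>E. l1_norm X (\<lambda>z. a x z - a y z) < \<epsilon>))"

definition words :: "'a set \<Rightarrow> 'a \<Rightarrow> 'a list set" where
  "words X x0 = lists (X - {x0})"

(* The zeroth power is E \<inter> Id rather than the full diagonal (E need not be reflexive). *)

definition ent_pow :: "('a \<times> 'a) set \<Rightarrow> nat \<Rightarrow> ('a \<times> 'a) set" where
  "ent_pow E k = (if k = 0 then E \<inter> Id else E ^^ k)"

(* In enat, Inf {} = \<infinity>. *)

definition ent_dist :: "('a \<times> 'a) set \<Rightarrow> 'a \<Rightarrow> 'a \<Rightarrow> enat" where
  "ent_dist E x y = Inf {enat k | k. (x, y) \<in> ent_pow E k}"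

definition norm_from :: "'a \<Rightarrow> ('a \<times> 'a) set \<Rightarrow> 'a list \<Rightarrow> enat" where
  "norm_from x0 E w = (\<Sum>x\<leftarrow>w. ent_dist E x0 x)"

definition norm_to :: "'a \<Rightarrow> ('a \<times> 'a) set \<Rightarrow> 'a list \<Rightarrow> enat" where
  "norm_to x0 E w = (\<Sum>x\<leftarrow>w. ent_dist E x x0)"

definition first_letter :: "'a \<Rightarrow> 'a list \<Rightarrow> 'a" where
  "first_letter x0 w = (if w = [] then x0 else hd w)"

(* After the longest common prefix, the remainders are bc and b'c'; an exhausted word has
   b = x0 and c = [], which agrees with tl [] = []. *)

definition word_dist :: "'a \<Rightarrow> ('a \<times> 'a) set \<Rightarrow> 'a list \<Rightarrow> 'a list \<Rightarrow> enat" where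
  "word_dist x0 E w w' =
     (if w = w' then 0 else
        let n = length (longest_common_prefix w w'); r = drop n w; r' = drop n w'
        in ent_dist E (first_letter x0 r) (first_letter x0 r')
           + norm_from x0 E (tl r) + norm_to x0 E (tl r'))"

definition word_ent :: "'a set \<Rightarrow> 'a \<Rightarrow> ('a \<times> 'a) set \<Rightarrow> nat \<Rightarrow> ('a list \<times> 'a list) set" where
  "word_ent X x0 E n =
     {(w, w') \<in> words X x0 \<times> words X x0. word_dist x0 E w w' \<le> enat n}"

definition free_coarse :: "'a set \<Rightarrow> 'a \<Rightarrow> ('a \<times> 'a) set set \<Rightarrow> ('a list \<times> 'a list) set set" where
  "free_coarse X x0 \<E> = {S. \<exists>E\<in>\<E>. \<exists>n. S \<subseteq> word_ent X x0 E n}"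

lemma ent_dist_le: "(x, y) \<in> ent_pow E k \<Longrightarrow> ent_dist E x y \<le> enat k"
  unfolding ent_dist_def by (auto intro: Inf_lower)

lemma ent_dist_attained:
  assumes "ent_dist E x y = enat k" shows "(x, y) \<in> ent_pow E k"
proof -
  let ?S = "{enat k | k. (x, y) \<in> ent_pow E k}"
  have "?S \<noteq> {}" 
    using assms by (cases "?S = {}") (auto simp: ent_dist_def top_enat_def)
  then have "Inf ?S \<in> ?S" by (metis (no_types, lifting) Inf_enat_def LeastI_ex ex_in_conv)
  then show ?thesis using assms by (auto simp: ent_dist_def)
qed

lemma ent_pow_mono: assumes "E \<subseteq> F" shows "ent_pow E k \<subseteq> ent_pow F k"
  using assms relpowp_mono[of "\<lambda>x y. (x, y) \<in> E" "\<lambda>x y. (x, y) \<in> F" k]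
  by (auto simp: ent_pow_def relpowp_relpow_eq)

lemma ent_dist_mono: assumes "E \<subseteq> F" shows "ent_dist F x y \<le> ent_dist E x y"
  using ent_dist_le[of x y F] ent_dist_attained[of E x y] ent_pow_mono[OF assms]
  by (cases "ent_dist E x y") auto

lemma ent_pow_add:
  assumes "(x, y) \<in> ent_pow E i" "(y, z) \<in> ent_pow E j" shows "(x, z) \<in> ent_pow E (i + j)"
  using assms by (auto simp: ent_pow_def relpow_add split: if_splits)

lemma ent_dist_triangle: "ent_dist E x z \<le> ent_dist E x y + ent_dist E y z"
proof (cases "ent_dist E x y")
  case (enat i)
  then show ?thesis
    by (cases "ent_dist E y z") (auto dest!: ent_dist_attained intro!: ent_dist_le dest: ent_pow_add)
qed auto

lemma ent_pow_converse: "ent_pow (E\<inverse>) k = (ent_pow E k)\<inverse>"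
proof -
  have "(E\<inverse>) ^^ k = (E ^^ k)\<inverse>"
    by (induction k) (simp, metis converse_relcomp relpow.simps(2) relpow_commute)
  then show ?thesis by (auto simp: ent_pow_def)
qed

lemma ent_dist_sym: assumes "E\<inverse> = E" shows "ent_dist E x y = ent_dist E y x"
proof -
  have "(x, y) \<in> ent_pow E k \<longleftrightarrow> (y, x) \<in> ent_pow E k" for k
    using ent_pow_converse[of E k] assms by auto
  then show ?thesis by (simp add: ent_dist_def)
qed

lemma norm_from_mono: "E \<subseteq> F \<Longrightarrow> norm_from x0 F w \<le> norm_from x0 E w"
  unfolding norm_from_def by (intro sum_list_mono ent_dist_mono)

lemma norm_to_mono: "E \<subseteq> F \<Longrightarrow> norm_to x0 F w \<le> norm_to x0 E w"
  unfolding norm_to_def by (intro sum_list_mono ent_dist_mono)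

lemma word_dist_mono: "E \<subseteq> F \<Longrightarrow> word_dist x0 F w w' \<le> word_dist x0 E w w'"
  by (auto simp: word_dist_def Let_def intro!: add_mono ent_dist_mono norm_from_mono norm_to_mono)

lemma word_ent_mono: "E \<subseteq> F \<Longrightarrow> n \<le> m \<Longrightarrow> word_ent X x0 E n \<subseteq> word_ent X x0 F m"
  unfolding word_ent_def by clarsimp (meson enat_ord_simps(1) order_trans word_dist_mono)

lemma word_dist_same [simp]: "word_dist x0 E (a # w) (a # w') = word_dist x0 E w w'"
  by (simp add: word_dist_def Let_def)

lemma word_dist_refl [simp]: "word_dist x0 E w w = 0"
  by (simp add: word_dist_def)

lemma word_dist_diff:
  "a \<noteq> b \<Longrightarrow> word_dist x0 E (a # w) (b # w') = ent_dist E a b + norm_from x0 E w + norm_to x0 E w'"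
  by (simp add: word_dist_def Let_def first_letter_def)

lemma word_dist_Nil_right: "word_dist x0 E (a # w) [] = ent_dist E a x0 + norm_from x0 E w"
  by (simp add: word_dist_def Let_def first_letter_def norm_to_def)

lemma word_dist_Nil_left: "word_dist x0 E [] (a # w) = ent_dist E x0 a + norm_to x0 E w"
  by (simp add: word_dist_def Let_def first_letter_def norm_from_def)

context
  fixes x0 :: 'a and G :: "('a \<times> 'a) set"
  assumes sym_G: "G\<inverse> = G"
begin

lemma norm_to_eq: "norm_to x0 G w = norm_from x0 G w"
  by (simp add: norm_to_def norm_from_def ent_dist_sym[OF sym_G, of _ x0])

lemma norm_from_Cons: "norm_from x0 G (a # w) = ent_dist G x0 a + norm_from x0 G w"
  by (simp add: norm_from_def)

lemma word_dist_sym: "word_dist x0 G w w' = word_dist x0 G w' w"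
proof (induction w arbitrary: w')
  case Nil
  show ?case
    by (cases w') (simp_all add: word_dist_Nil_left word_dist_Nil_right norm_to_eq norm_from_Cons
      ent_dist_sym[OF sym_G, of _ x0])
next
  case (Cons a w)
  show ?case
  proof (cases w')
    case Nil
    then show ?thesis
      by (simp add: word_dist_Nil_left word_dist_Nil_right norm_to_eq norm_from_Cons
        ent_dist_sym[OF sym_G, of _ x0])
  next
    case (Cons b v)
    then show ?thesis using Cons.IH
      by (cases "a = b") (simp_all add: word_dist_diff norm_to_eq ent_dist_sym[OF sym_G, of a b] add_ac)
  qed
qed

lemma word_dist_Nil: "word_dist x0 G [] w = norm_from x0 G w" "word_dist x0 G w [] = norm_from x0 G w"
proof -
  show 1: "word_dist x0 G [] w = norm_from x0 G w"
    by (cases w) (simp_all add: word_dist_Nil_left norm_to_eq norm_from_def)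
  show "word_dist x0 G w [] = norm_from x0 G w"
    using 1 word_dist_sym by metis
qed

lemma word_dist_le: "word_dist x0 G w w' \<le> norm_from x0 G w + norm_from x0 G w'"
proof (induction w arbitrary: w')
  case Nil
  show ?case by (simp add: word_dist_Nil)
next
  case (Cons a w)
  show ?case
  proof (cases w')
    case Nil
    then show ?thesis by (simp add: word_dist_Nil norm_from_def)
  next
    case (Cons b v)
    have "ent_dist G a b + norm_from x0 G w + norm_from x0 G v
        \<le> (ent_dist G x0 a + ent_dist G x0 b) + norm_from x0 G w + norm_from x0 G v"
      using ent_dist_triangle[of G a b x0] ent_dist_sym[OF sym_G, of a x0] by (intro add_mono) auto
    moreover have "norm_from x0 G w + norm_from x0 G v
        \<le> norm_from x0 G (a # w) + norm_from x0 G (b # v)"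
      unfolding norm_from_Cons by (intro add_mono) auto
    ultimately show ?thesis using Cons.IH[of v] Cons
      by (cases "a = b") (auto simp: word_dist_diff norm_to_eq norm_from_Cons add_ac intro: order_trans)
  qed
qed

lemma norm_from_le: "norm_from x0 G w \<le> word_dist x0 G w w' + norm_from x0 G w'"
proof (induction w arbitrary: w')
  case Nil
  show ?case by (simp add: norm_from_def)
next
  case (Cons a w)
  show ?case
  proof (cases w')
    case Nil
    then show ?thesis by (simp add: word_dist_Nil norm_from_def)
  next
    case (Cons b v)
    show ?thesis
    proof (cases "a = b")
      case True
      then show ?thesis using Cons.IH[of v] Cons
        using add_left_mono[OF Cons.IH[of v], of "ent_dist G x0 a"]
        by (simp add: norm_from_Cons add_ac)
    next
      case False
      have "ent_dist G x0 a + norm_from x0 G w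
          \<le> (ent_dist G x0 b + ent_dist G a b) + (norm_from x0 G w + (norm_from x0 G v + norm_from x0 G v))"
        using ent_dist_triangle[of G x0 a b] ent_dist_sym[OF sym_G, of b a]
        by (intro add_mono) auto
      then show ?thesis using False Cons
        by (simp add: word_dist_diff norm_to_eq norm_from_Cons add_ac)
    qed
  qed
qed

lemma word_dist_triangle: "word_dist x0 G u w \<le> word_dist x0 G u v + word_dist x0 G v w"
proof (induction u arbitrary: v w)
  case Nil
  show ?case
    using norm_from_le[of w v] word_dist_sym[of v w] by (simp add: word_dist_Nil add.commute)
next
  case (Cons a u)
  show ?case
  proof (cases v)
    case Nil
    then show ?thesis using word_dist_le by (simp add: word_dist_Nil)
  next
    case v: (Cons b v')
    show ?thesis
    proof (cases w)
      case Nil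
      then show ?thesis using norm_from_le by (simp add: word_dist_Nil)
    next
      case w: (Cons c w')
      consider "a = c" "a = b" | "a = c" "a \<noteq> b" | "a \<noteq> c" "a = b" | "a \<noteq> c" "b = c"
        | "a \<noteq> c" "a \<noteq> b" "b \<noteq> c" by blast
      then show ?thesis
      proof cases
        case 1
        then show ?thesis using Cons.IH v w by simp
      next
        case 2
        have "word_dist x0 G u w' \<le> norm_from x0 G u + norm_from x0 G w'"
          by (rule word_dist_le)
        also have "\<dots> \<le> (ent_dist G a b + norm_from x0 G u + norm_from x0 G v')
            + (ent_dist G b a + norm_from x0 G v' + norm_from x0 G w')"
          by (intro add_mono) (auto simp: add_ac)
        finally show ?thesis using 2 v w by (simp add: word_dist_diff norm_to_eq)
      next
        case 3
        have "ent_dist G a c + norm_from x0 G u + norm_from x0 G w'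
           \<le> ent_dist G a c + (word_dist x0 G u v' + norm_from x0 G v') + norm_from x0 G w'"
          using norm_from_le by (intro add_mono) auto
        then show ?thesis using 3 v w by (simp add: word_dist_diff norm_to_eq add_ac)
      next
        case 4
        have "ent_dist G a c + norm_from x0 G u + norm_from x0 G w'
           \<le> ent_dist G a c + norm_from x0 G u + (word_dist x0 G v' w' + norm_from x0 G v')"
          using norm_from_le[of w' v'] word_dist_sym[of w' v'] by (intro add_mono) auto
        then show ?thesis using 4 v w by (simp add: word_dist_diff norm_to_eq add_ac)
      next
        case 5
        have "ent_dist G a c + norm_from x0 G u + norm_from x0 G w'
           \<le> (ent_dist G a b + ent_dist G b c) + norm_from x0 G u
              + (norm_from x0 G w' + (norm_from x0 G v' + norm_from x0 G v'))"
          using ent_dist_triangle by (intro add_mono) auto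
        then show ?thesis using 5 v w by (simp add: word_dist_diff norm_to_eq add_ac)
      qed
    qed
  qed
qed

end

theorem coarse_space_free_coarse:
  assumes "coarse_space X \<E>"
  shows "coarse_space (words X x0) (free_coarse X x0 \<E>)"
proof -
  interpret coarse_space X \<E> by fact
  have sub: "word_ent X x0 E n \<subseteq> words X x0 \<times> words X x0" for E n
    by (auto simp: word_ent_def)
  have sym_ent: "\<exists>G\<in>\<E>. E \<union> F \<subseteq> G \<and> G\<inverse> = G" if "E \<in> \<E>" "F \<in> \<E>" for E F
    using that by (intro bexI[of _ "(E \<union> F) \<union> (E \<union> F)\<inverse>"]) (auto intro!: union inverse)
  have word_ent_sym: "(word_ent X x0 G n)\<inverse> = word_ent X x0 G n" if "G\<inverse> = G" for G n
    using word_dist_sym[OF that, of x0] by (auto simp: word_ent_def)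
  show ?thesis
  proof
    show "S \<subseteq> words X x0 \<times> words X x0" if "S \<in> free_coarse X x0 \<E>" for S
      using that sub by (fastforce simp: free_coarse_def)
    show "Id_on (words X x0) \<in> free_coarse X x0 \<E>"
      using diagonal by (auto simp: free_coarse_def word_ent_def intro!: bexI[of _ "Id_on X"])
    show "S\<inverse> \<in> free_coarse X x0 \<E>" if S: "S \<in> free_coarse X x0 \<E>" for S
    proof -
      obtain E n where E: "E \<in> \<E>" "S \<subseteq> word_ent X x0 E n"
        using S by (auto simp: free_coarse_def)
      obtain G where G: "G \<in> \<E>" "E \<subseteq> G" "G\<inverse> = G" using sym_ent[OF E(1) E(1)] by auto
      have "S\<inverse> \<subseteq> (word_ent X x0 G n)\<inverse>" using E(2) word_ent_mono[OF G(2) order_refl] by blast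
      then show ?thesis using G word_ent_sym by (auto simp: free_coarse_def)
    qed
    show "T \<in> free_coarse X x0 \<E>" if "S \<in> free_coarse X x0 \<E>" "T \<subseteq> S" for S T
      using that by (auto simp: free_coarse_def)
    fix S T assume ST: "S \<in> free_coarse X x0 \<E>" "T \<in> free_coarse X x0 \<E>"
    then obtain E F n m where E: "E \<in> \<E>" "S \<subseteq> word_ent X x0 E n"
      and F: "F \<in> \<E>" "T \<subseteq> word_ent X x0 F m"
      by (auto simp: free_coarse_def)
    obtain G where G: "G \<in> \<E>" "E \<subseteq> G" "F \<subseteq> G" "G\<inverse> = G" using sym_ent[OF E(1) F(1)] by auto
    have S: "S \<subseteq> word_ent X x0 G n" and T: "T \<subseteq> word_ent X x0 G m"
      using E F word_ent_mono[OF G(2) order_refl] word_ent_mono[OF G(3) order_refl] by blast+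
    have "S \<union> T \<subseteq> word_ent X x0 G (max n m)"
      using S T word_ent_mono[of G G n "max n m"] word_ent_mono[of G G m "max n m"]
      by (meson Un_least max.cobounded1 max.cobounded2 order_refl order_trans)
    then show "S \<union> T \<in> free_coarse X x0 \<E>" using G by (auto simp: free_coarse_def)
    have "S O T \<subseteq> word_ent X x0 G (n + m)"
    proof
      fix p assume "p \<in> S O T"
      then obtain u v w where p: "p = (u, w)" and uv: "(u, v) \<in> word_ent X x0 G n"
        and vw: "(v, w) \<in> word_ent X x0 G m" using S T by blast
      have "word_dist x0 G u w \<le> word_dist x0 G u v + word_dist x0 G v w"
        by (rule word_dist_triangle[OF G(4)])
      also have "\<dots> \<le> enat n + enat m"
        using uv vw by (intro add_mono) (auto simp: word_ent_def)
      finally show "p \<in> word_ent X x0 G (n + m)" using p uv vw by (auto simp: word_ent_def)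
    qed
    then show "S O T \<in> free_coarse X x0 \<E>" using G by (auto simp: free_coarse_def)
  qed
qed

end

theory Submission
  imports Defs
begin

text \<open>Words form a tree of copies of \<open>X\<close>: each word \<open>v\<close> is the basepoint of the copy
  \<open>{vb | b \<in> X}\<close>, where \<open>v x0 = v\<close>. Choose measures \<open>a_b\<close> on \<open>X\<close> witnessing property A with \<open>a_{x0}\<close> the point mass
  at \<open>x0\<close>. Starting from \<open>w = vb\<close>, spread mass over the copy at \<open>v\<close> using \<open>a_b\<close>; the mass landing on
  the basepoint \<open>v\<close> continues from \<open>v\<close> in the next copy towards the root, for at most \<open>n\<close> rounds.
  Since \<open>a_{x0}\<close> is a point mass, \<open>n + 1\<close> rounds from \<open>vb\<close> with \<open>b\<close> near \<open>x0\<close> agree up to a small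
  error with \<open>n\<close> rounds from \<open>v\<close>, so averaging over \<open>n < N\<close>, as for property A of trees, gives slowly
  varying measures. Their variation along an entourage follows by interpolating between two words
  one letter move at a time.\<close>

section \<open>Probability measures on a set and estimates in l^1\<close>

definition prob_on :: "'a set \<Rightarrow> ('a \<Rightarrow> real) \<Rightarrow> bool" where
  "prob_on X p \<longleftrightarrow> (\<forall>y\<in>X. 0 \<le> p y) \<and> (p has_sum 1) X"

text \<open>For nonnegative \<open>p\<close> the absolute values disappear, and
  \<open>has_sum\<close> bundles summability with the total mass. This translates between
  \<open>prob_on\<close> and the form used in \<open>coarse_property_A\<close>.\<close>

lemma prob_on_iff_l1: "prob_on X p \<longleftrightarrow> p \<in> l1 X \<and> (\<forall>y\<in>X. 0 \<le> p y) \<and> l1_norm X p = 1"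
proof -
  have "p \<in> l1 X \<longleftrightarrow> p summable_on X" "l1_norm X p = infsum p X" if "\<forall>y\<in>X. 0 \<le> p y"
    using that summable_on_cong[of X "\<lambda>y. \<bar>p y\<bar>" p] infsum_cong[of X "\<lambda>y. \<bar>p y\<bar>" p]
    by (auto simp: l1_def l1_norm_def)
  then show ?thesis by (auto simp: prob_on_def has_sum_iff)
qed

lemma prob_on_point: "x \<in> X \<Longrightarrow> prob_on X (\<lambda>y. of_bool (y = x))"
  unfolding prob_on_def by (auto intro!: has_sum_finite_neutralI[of "{x}"])

lemma prob_on_convex:
  assumes "prob_on X p" "prob_on X q" "0 \<le> t" "t \<le> 1"
  shows "prob_on X (\<lambda>y. t * p y + (1 - t) * q y)"
proof -
  have "((\<lambda>y. t * p y + (1 - t) * q y) has_sum t * 1 + (1 - t) * 1) X"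
    using assms by (intro has_sum_add has_sum_cmult_right) (auto simp: prob_on_def)
  then show ?thesis using assms by (auto simp: prob_on_def)
qed

lemma prob_on_average:
  fixes N :: nat
  assumes "\<And>n. n < N \<Longrightarrow> prob_on X (p n)" "N > 0"
  shows "prob_on X (\<lambda>y. (\<Sum>n<N. p n y) / N)"
proof -
  have "((\<lambda>y. \<Sum>n<m. p n y) has_sum of_nat m) X" if "m \<le> N" for m
    using that
  proof (induction m)
    case (Suc m)
    then have "((\<lambda>y. (\<Sum>n<m. p n y) + p m y) has_sum of_nat m + 1) X"
      using assms by (intro has_sum_add) (auto simp: prob_on_def)
    then show ?case by (simp add: add.commute)
  qed auto
  then have "((\<lambda>y. (1 / N) * (\<Sum>n<N. p n y)) has_sum (1 / N) * of_nat N) X"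
    by (intro has_sum_cmult_right) auto
  then show ?thesis
    using assms by (auto simp: prob_on_def intro!: divide_nonneg_nonneg sum_nonneg)
qed

lemma has_sum_abs_l1_norm:
  fixes f :: "'a \<Rightarrow> real"
  assumes "f summable_on X" shows "((\<lambda>y. \<bar>f y\<bar>) has_sum l1_norm X f) X"
  using assms summable_on_iff_abs_summable_on_real[of f X] by (simp add: l1_norm_def)

lemma prob_on_diff_has_sum:
  assumes "prob_on X p" "prob_on X q"
  shows "((\<lambda>y. \<bar>p y - q y\<bar>) has_sum l1_norm X (\<lambda>y. p y - q y)) X"
proof -
  have "(\<lambda>y. p y + - 1 * q y) summable_on X"
    using assms by (intro summable_on_add summable_on_cmult_right)
      (auto simp: prob_on_def has_sum_iff)
  then show ?thesis using has_sum_abs_l1_norm[of "\<lambda>y. p y - q y"] by simp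
qed

lemma l1_norm_le:
  assumes g: "(g has_sum c) X" and le: "\<And>y. y \<in> X \<Longrightarrow> \<bar>f y\<bar> \<le> g y"
  shows "l1_norm X f \<le> c"
proof (cases "(\<lambda>y. \<bar>f y\<bar>) summable_on X")
  case True
  then show ?thesis
    using has_sum_mono[OF _ g, of "\<lambda>y. \<bar>f y\<bar>"] le by (auto simp: l1_norm_def)
next
  \<comment> \<open>Without summability \<open>infsum\<close> defaults to 0, so only the sign of
    \<open>c\<close> matters.\<close>
  case False
  have "0 \<le> c" using has_sum_nonneg[OF g] le by (meson abs_ge_zero order_trans)
  then show ?thesis using False by (simp add: l1_norm_def infsum_not_exists)
qed

lemma l1_norm_prob_on_triangle:
  assumes "prob_on X p" "prob_on X q" "prob_on X r"
  shows "l1_norm X (\<lambda>y. p y - r y)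
    \<le> l1_norm X (\<lambda>y. p y - q y) + l1_norm X (\<lambda>y. q y - r y)"
  by (rule l1_norm_le[OF has_sum_add[OF prob_on_diff_has_sum prob_on_diff_has_sum]])
     (use assms in auto)

lemma l1_norm_diff_commute: "l1_norm X (\<lambda>y. p y - q y) = l1_norm X (\<lambda>y. q y - p y)"
  by (simp add: l1_norm_def abs_minus_commute)

section \<open>Property A normalised at the basepoint\<close>

text \<open>The average of the indicators of \<open>F, F\<^sup>2, \<dots>, F\<^sup>M\<close> at \<open>(x, x0)\<close> decays slowly in \<open>x\<close>;
  mixing with the point mass at \<open>x0\<close> in this proportion makes the value at \<open>x0\<close> exact.\<close>

lemma property_A_based:
  assumes "coarse_space X \<E>" "coarse_property_A X \<E>" and x0: "x0 \<in> X"
    and \<epsilon>: "\<epsilon> > 0" and E: "E \<in> \<E>"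
  obtains K a where "K \<in> \<E>" "K\<inverse> = K" "\<And>x. x \<in> X \<Longrightarrow> prob_on X (a x)"
    "\<And>y. a x0 y = of_bool (y = x0)"
    "\<And>x y. x \<in> X \<Longrightarrow> y \<in> X \<Longrightarrow> a x y \<noteq> 0 \<Longrightarrow> (x, y) \<in> K"
    "\<And>x y. (x, y) \<in> E \<Longrightarrow> l1_norm X (\<lambda>z. a x z - a y z) < \<epsilon>"
proof -
  interpret coarse_space X \<E> by fact
  \<comment> \<open>Reflexivity on X puts (x0, x0) in every power, giving \<open>t x0 = 1\<close>;
    symmetry lets \<open>step\<close> bound \<open>t x - t y\<close> in both directions.\<close>
  define F where "F = E \<union> E\<inverse> \<union> Id_on X"
  have F: "F \<in> \<E>" unfolding F_def using E by (intro union inverse diagonal)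
  have "\<exists>K\<in>\<E>. \<exists>a. (\<forall>x\<in>X. a x \<in> l1 X \<and> (\<forall>y\<in>X. 0 \<le> a x y) \<and> l1_norm X (a x) = 1) \<and>
        (\<forall>x\<in>X. \<forall>y\<in>X. a x y \<noteq> 0 \<longrightarrow> (x, y) \<in> K) \<and>
        (\<forall>(x, y)\<in>E. l1_norm X (\<lambda>z. a x z - a y z) < \<epsilon> / 2)"
    by (rule assms(2)[unfolded coarse_property_A_def, THEN spec, THEN mp, THEN bspec])
      (use \<epsilon> E in auto)
  then obtain K a where K: "K \<in> \<E>" and a: "\<And>x. x \<in> X \<Longrightarrow> prob_on X (a x)"
    and supp: "\<And>x y. x \<in> X \<Longrightarrow> y \<in> X \<Longrightarrow> a x y \<noteq> 0 \<Longrightarrow> (x, y) \<in> K"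
    and var: "\<And>x y. (x, y) \<in> E \<Longrightarrow> l1_norm X (\<lambda>z. a x z - a y z) < \<epsilon> / 2"
    unfolding prob_on_iff_l1 by fast
  \<comment> \<open>Half of \<epsilon> is reserved for the variation of \<open>a\<close>. The
    variation of \<open>t\<close> enters twice, with weight 1/M each time, and must fit into the
    other half.\<close>
  obtain M :: nat where "2 / (\<epsilon> / 2) < M" using reals_Archimedean2 by blast
  moreover have "0 < 2 / (\<epsilon> / 2)" using \<epsilon> by simp
  ultimately have M0: "M > 0" and "2 / (\<epsilon> / 2) < M" by (auto intro!: Nat.gr0I)
  then have M: "2 / M \<le> \<epsilon> / 2" using \<epsilon> by (simp add: field_simps)
  define g where "g x m = (of_bool ((x, x0) \<in> F ^^ m) :: real)" for x m
  define t where "t x = (\<Sum>m=1..M. g x m) / M" for x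
  have g01: "0 \<le> g x m" "g x m \<le> 1" for x m by (auto simp: g_def)
  have t01: "0 \<le> t x" "t x \<le> 1" for x
    using M0 sum_bounded_above[of "{1..M}" "g x" 1] g01
    by (auto simp: t_def sum_nonneg)
  have "(x0, x0) \<in> F ^^ m" for m
    by (induction m) (use x0 in \<open>auto simp: F_def\<close>)
  then have t0: "t x0 = 1" using M0 by (simp add: t_def g_def)
  \<comment> \<open>Prepending the edge (x, y) turns a path of length m from y to x0 into one of
    length m + 1 from x. The shifted sum exceeds the original by at most one term, which is at most
    1.\<close>
  have step: "t y \<le> t x + 1 / M" if "(x, y) \<in> F" for x y
  proof -
    have "g y m \<le> g x (Suc m)" for m
      using relpow_Suc_I2[OF that] by (auto simp: g_def)
    then have "(\<Sum>m=1..M. g y m) \<le> (\<Sum>m=1..M. g x (Suc m))" by (intro sum_mono)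
    also have "\<dots> = (\<Sum>m=Suc 1..Suc M. g x m)" by (rule sum.shift_bounds_cl_Suc_ivl[symmetric])
    also have "\<dots> \<le> (\<Sum>m=1..Suc M. g x m)" using g01 by (intro sum_mono2) auto
    also have "\<dots> \<le> (\<Sum>m=1..M. g x m) + 1" using g01 by simp
    finally show ?thesis using M0 by (simp add: t_def field_simps)
  qed
  have tvar: "\<bar>t x - t y\<bar> \<le> 1 / M" if "(x, y) \<in> E" for x y
    using step[of x y] step[of y x] that by (auto simp: F_def abs_if)
  define b where "b x y = t x * of_bool (y = x0) + (1 - t x) * a x y" for x y
  \<comment> \<open>\<open>F ^^ 0\<close> is the identity on the whole type and may leave X, hence
    the positive exponents.\<close>
  have pow: "F ^^ Suc m \<in> \<E>" for m
    by (induction m) (use F in \<open>auto intro: composition\<close>)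
  have pows: "(\<Union>m\<in>{1..n}. F ^^ m) \<in> \<E>" for n
  proof (induction n)
    case 0
    then show ?case using subset[OF F, of "{}"] by simp
  next
    case (Suc n)
    have "(\<Union>m\<in>{1..Suc n}. F ^^ m) = (\<Union>m\<in>{1..n}. F ^^ m) \<union> F ^^ Suc n"
      by (auto simp: atLeastAtMostSuc_conv simp del: relpow.simps)
    then show ?case using Suc pow[of n] by (simp add: union del: relpow.simps)
  qed
  \<comment> \<open>\<open>K\<close> carries the support of \<open>a\<close>; the powers of
    \<open>F\<close> carry the point mass at x0, which has positive weight only if some
    \<open>(x, x0)\<close> lies in \<open>F ^^ m\<close> with 1 \<le> m \<le> M.\<close>
  define L where "L = K \<union> (\<Union>m\<in>{1..M}. F ^^ m)"
  have L: "L \<in> \<E>" unfolding L_def using K pows by (intro union)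
  show thesis
  proof
    show "L \<union> L\<inverse> \<in> \<E>" using L by (intro union inverse)
    show "(L \<union> L\<inverse>)\<inverse> = L \<union> L\<inverse>" by auto
    show prob: "prob_on X (b x)" if "x \<in> X" for x
      unfolding b_def using that a t01 x0 by (intro prob_on_convex prob_on_point)
    show "b x0 y = of_bool (y = x0)" for y by (simp add: b_def t0)
    show "(x, y) \<in> L \<union> L\<inverse>" if "x \<in> X" "y \<in> X" "b x y \<noteq> 0" for x y
    proof (cases "a x y = 0")
      case True
      then have y: "y = x0" and "t x \<noteq> 0" using that by (auto simp: b_def split: if_splits)
      then obtain m where "m \<in> {1..M}" "g x m \<noteq> 0"
        unfolding t_def by (metis div_0 sum.neutral)
      then show ?thesis using y by (auto simp: g_def L_def)
    next
      case False
      then show ?thesis using that supp by (auto simp: L_def)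
    qed
    show "l1_norm X (\<lambda>z. b x z - b y z) < \<epsilon>" if xy: "(x, y) \<in> E" for x y
    proof -
      have X: "x \<in> X" "y \<in> X" using subset_carrier[OF E] xy by auto
      have 1: "((\<lambda>z. (1 / M) * of_bool (z = x0) + (1 / M) * a y z + \<bar>a x z - a y z\<bar>)
          has_sum (1 / M) * 1 + (1 / M) * 1 + l1_norm X (\<lambda>z. a x z - a y z)) X"
        using X a prob_on_point[OF x0] unfolding prob_on_def
        by (intro has_sum_add has_sum_cmult_right prob_on_diff_has_sum) (auto simp: a)
      have 2: "\<bar>b x z - b y z\<bar> \<le> (1 / M) * of_bool (z = x0) + (1 / M) * a y z + \<bar>a x z - a y z\<bar>"
        if "z \<in> X" for z
      proof -
        \<comment> \<open>The first two terms are controlled by the variation of \<open>t\<close>,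
          the last by that of \<open>a\<close>, with coefficient \<open>1 - t x\<close> in
          [0, 1].\<close>
        have "b x z - b y z = (t x - t y) * of_bool (z = x0) + (t y - t x) * a y z
            + (1 - t x) * (a x z - a y z)"
          by (simp add: b_def algebra_simps)
        also have "\<bar>\<dots>\<bar> \<le> \<bar>(t x - t y) * of_bool (z = x0)\<bar> + \<bar>(t y - t x) * a y z\<bar>
            + \<bar>(1 - t x) * (a x z - a y z)\<bar>"
          by linarith
        also have "\<dots> = \<bar>t x - t y\<bar> * of_bool (z = x0) + \<bar>t y - t x\<bar> * \<bar>a y z\<bar>
            + \<bar>1 - t x\<bar> * \<bar>a x z - a y z\<bar>"
          by (simp add: abs_mult)
        also have "\<dots> \<le> (1 / M) * of_bool (z = x0) + (1 / M) * a y z + 1 * \<bar>a x z - a y z\<bar>"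
        proof (intro add_mono mult_mono)
          show "\<bar>a y z\<bar> \<le> a y z" using a[OF X(2)] that by (auto simp: prob_on_def)
        qed (use tvar[OF xy] t01[of x] in \<open>auto simp: abs_minus_commute\<close>)
        finally show ?thesis by simp
      qed
      show ?thesis using l1_norm_le[OF 1 2] var[OF xy] M by simp
    qed
  qed
qed

section \<open>Words as a tree of copies of X, and interpolation between words\<close>

text \<open>For a word \<open>v\<close>, the words \<open>snoc_letter x0 v b\<close> with \<open>b \<in> X\<close> form a copy of \<open>X\<close>
  whose basepoint is \<open>v\<close> itself.\<close>

definition snoc_letter :: "'a \<Rightarrow> 'a list \<Rightarrow> 'a \<Rightarrow> 'a list" where
  "snoc_letter x0 v b = (if b = x0 then v else v @ [b])"

lemma snoc_letter_base [simp]: "snoc_letter x0 v x0 = v"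
  by (simp add: snoc_letter_def)

lemma Nil_in_words [simp]: "[] \<in> words X x0"
  by (simp add: words_def)

lemma append_in_words [simp]: "u @ v \<in> words X x0 \<longleftrightarrow> u \<in> words X x0 \<and> v \<in> words X x0"
  by (auto simp: words_def)

lemma singleton_in_words [simp]: "[b] \<in> words X x0 \<longleftrightarrow> b \<in> X \<and> b \<noteq> x0"
  by (auto simp: words_def)

lemma snoc_letter_in_words: "v \<in> words X x0 \<Longrightarrow> b \<in> X \<Longrightarrow> snoc_letter x0 v b \<in> words X x0"
  by (simp add: snoc_letter_def)

lemma words_snoc_cases:
  assumes "w \<in> words X x0"
  obtains "w = []" | v b where "w = v @ [b]" "v \<in> words X x0" "b \<in> X" "b \<noteq> x0"
  using assms by (cases w rule: rev_cases) auto

lemma last_in_words: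
  assumes "w \<in> words X x0" "w \<noteq> []" shows "last w \<in> X" "last w \<noteq> x0"
  using assms last_in_set[of w] by (auto simp: words_def)

lemma word_dist_append_same: "word_dist x0 E (v @ w) (v @ w') = word_dist x0 E w w'"
  by (induction v) auto

text \<open>After cancelling the prefix \<open>v\<close> only single letters or empty words remain.
  Equality can fail when b = c: the left side is then 0, but \<open>ent_dist E b b\<close> is
  positive unless (b, b) is in \<open>E\<close>.\<close>

lemma word_dist_snoc_letter_le:
  "word_dist x0 E (snoc_letter x0 v b) (snoc_letter x0 v c) \<le> ent_dist E b c"
  using word_dist_append_same[of x0 E v "[b]" "[c]"] word_dist_append_same[of x0 E v "[]" "[c]"]
    word_dist_append_same[of x0 E v "[b]" "[]"]
  by (cases "b = c") (auto simp: snoc_letter_def word_dist_diff word_dist_Nil_left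
      word_dist_Nil_right norm_from_def norm_to_def)

text \<open>The value of \<open>word_dist\<close> counts \<open>E\<close>-steps inside copies of X
  along a route from \<open>w\<close> to \<open>w'\<close>, and each such step costs at most \<eta>.
  The triangle inequality is asked for words only, since in the application \<rho> is the l^1
  distance of measures attached to words.\<close>

lemma word_dist_bounds_pseudometric:
  fixes \<rho> :: "'a list \<Rightarrow> 'a list \<Rightarrow> real"
  assumes x0: "x0 \<in> X" and E: "E \<subseteq> X \<times> X"
    and refl: "\<And>u. \<rho> u u = 0" and sym: "\<And>u v. \<rho> u v = \<rho> v u"
    and tri: "\<And>u v w. u \<in> words X x0 \<Longrightarrow> v \<in> words X x0 \<Longrightarrow> w \<in> words X x0 \<Longrightarrow>
      \<rho> u w \<le> \<rho> u v + \<rho> v w"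
    and step: "\<And>v b c. v \<in> words X x0 \<Longrightarrow> (b, c) \<in> E \<Longrightarrow>
      \<rho> (snoc_letter x0 v b) (snoc_letter x0 v c) \<le> \<eta>"
    and \<eta>: "0 \<le> \<eta>"
    and w: "w \<in> words X x0" "w' \<in> words X x0" and le: "word_dist x0 E w w' \<le> enat m"
  shows "\<rho> w w' \<le> \<eta> * m"
proof -
  have pow: "\<rho> (snoc_letter x0 v b) (snoc_letter x0 v c) \<le> \<eta> * k"
    if v: "v \<in> words X x0" and "b \<in> X" "(b, c) \<in> E ^^ k" for v b c k
    using that(3)
  proof (induction k arbitrary: c)
    case 0
    then show ?case by (simp add: refl)
  next
    case (Suc k)
    then obtain d where d: "(b, d) \<in> E ^^ k" "(d, c) \<in> E" by auto
    then have "\<rho> (snoc_letter x0 v b) (snoc_letter x0 v c)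
        \<le> \<rho> (snoc_letter x0 v b) (snoc_letter x0 v d) + \<rho> (snoc_letter x0 v d) (snoc_letter x0 v c)"
      using E v \<open>b \<in> X\<close> by (intro tri snoc_letter_in_words) auto
    also have "\<dots> \<le> \<eta> * k + \<eta>" using Suc.IH d step v by (intro add_mono)
    finally show ?case by (simp add: algebra_simps)
  qed
  \<comment> \<open>Distance 0 comes from \<open>E \<inter> Id\<close>, so it forces b = c and costs
    nothing.\<close>
  have letter: "\<rho> (snoc_letter x0 v b) (snoc_letter x0 v c) \<le> \<eta> * k"
    if "v \<in> words X x0" "b \<in> X" "ent_dist E b c = enat k" for v b c k
    using ent_dist_attained[OF that(3)] pow[OF that(1,2)]
    by (auto simp: ent_pow_def refl split: if_splits)
  \<comment> \<open>The letter weight \<open>d\<close> is left abstract so that one induction serves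
    both \<open>norm_from\<close> and \<open>norm_to\<close>. Reverse induction fits because each
    appended letter is a move in the copy at the word built so far.\<close>
  have tail: "\<rho> v (v @ c) \<le> \<eta> * k"
    if v: "v \<in> words X x0" and "c \<in> words X x0" "sum_list (map d c) = enat k"
      and d: "\<And>u x j. u \<in> words X x0 \<Longrightarrow> x \<in> X \<Longrightarrow> x \<noteq> x0 \<Longrightarrow> d x = enat j \<Longrightarrow>
        \<rho> u (u @ [x]) \<le> \<eta> * j"
    for v c k and d :: "'a \<Rightarrow> enat"
    using that(2,3)
  proof (induction c arbitrary: k rule: rev_induct)
    case Nil
    then show ?case using \<eta> by (simp add: refl)
  next
    case (snoc x c)
    from snoc.prems obtain i j where ij: "sum_list (map d c) = enat i" "d x = enat j" "k = i + j"
      by (cases "sum_list (map d c)"; cases "d x") auto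
    have "\<rho> v (v @ c @ [x]) \<le> \<rho> v (v @ c) + \<rho> (v @ c) ((v @ c) @ [x])"
      using tri[of v "v @ c" "v @ c @ [x]"] v snoc.prems by simp
    also have "\<dots> \<le> \<eta> * i + \<eta> * j"
      using snoc ij v by (intro add_mono d) auto
    finally show ?case using ij by (simp add: algebra_simps)
  qed
  have from_tail: "\<rho> v (v @ c) \<le> \<eta> * k"
    if "v \<in> words X x0" "c \<in> words X x0" "norm_from x0 E c = enat k" for v c k
  proof (rule tail[OF that[unfolded norm_from_def]])
    show "\<rho> u (u @ [x]) \<le> \<eta> * j"
      if "u \<in> words X x0" "x \<in> X" "x \<noteq> x0" "ent_dist E x0 x = enat j" for u x j
      using letter[OF that(1) x0 that(4)] that by (simp add: snoc_letter_def)
  qed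
  \<comment> \<open>Here the \<open>E\<close>-path runs from the letter to x0, that is from
    \<open>u @ [x]\<close> back to \<open>u\<close>; symmetry of \<rho> reverses it.\<close>
  have to_tail: "\<rho> v (v @ c) \<le> \<eta> * k"
    if "v \<in> words X x0" "c \<in> words X x0" "norm_to x0 E c = enat k" for v c k
  proof (rule tail[OF that[unfolded norm_to_def]])
    show "\<rho> u (u @ [x]) \<le> \<eta> * j"
      if "u \<in> words X x0" "x \<in> X" "x \<noteq> x0" "ent_dist E x x0 = enat j" for u x j
      using letter[OF that(1,2,4)] that sym by (simp add: snoc_letter_def)
  qed
  show ?thesis
  proof (cases "w = w'")
    case True
    then show ?thesis using \<eta> by (simp add: refl)
  next
    case False
    define u where "u = longest_common_prefix w w'"
    obtain r where r: "w = u @ r"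
      using longest_common_prefix_prefix1[of w w'] by (auto simp: u_def elim: prefixE)
    obtain r' where r': "w' = u @ r'"
      using longest_common_prefix_prefix2[of w w'] by (auto simp: u_def elim: prefixE)
    define b where "b = first_letter x0 r"
    define b' where "b' = first_letter x0 r'"
    have words: "u \<in> words X x0" "r \<in> words X x0" "r' \<in> words X x0" using w r r' by auto
    \<comment> \<open>An exhausted remainder has first letter x0, whose point in the copy at
      \<open>u\<close> is \<open>u\<close> itself, so both shapes of remainder are treated
      alike.\<close>
    have split: "u @ s = snoc_letter x0 u (first_letter x0 s) @ tl s \<and> first_letter x0 s \<in> X
        \<and> tl s \<in> words X x0" if "s \<in> words X x0" for s
      using that x0 by (cases s) (auto simp: first_letter_def snoc_letter_def words_def)
    have "word_dist x0 E w w' = ent_dist E b b' + norm_from x0 E (tl r) + norm_to x0 E (tl r')"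
    proof -
      have "drop (length u) w = r" "drop (length u) w' = r'" by (simp_all add: r r')
      then show ?thesis
        using False by (simp only: word_dist_def Let_def b_def b'_def if_False flip: u_def)
    qed
    with le obtain i j k where ijk: "ent_dist E b b' = enat i" "norm_from x0 E (tl r) = enat j"
      "norm_to x0 E (tl r') = enat k" "i + j + k \<le> m"
      by (cases "ent_dist E b b'"; cases "norm_from x0 E (tl r)"; cases "norm_to x0 E (tl r')") auto
    let ?v = "snoc_letter x0 u b" and ?v' = "snoc_letter x0 u b'"
    have s: "w = ?v @ tl r" "w' = ?v' @ tl r'" "b \<in> X" "b' \<in> X"
      "tl r \<in> words X x0" "tl r' \<in> words X x0"
      using split words by (simp_all add: r r' b_def b'_def)
    then have v: "?v \<in> words X x0" "?v' \<in> words X x0"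
      using words by (auto intro: snoc_letter_in_words)
    \<comment> \<open>The route deletes the tail of \<open>w\<close>, moves within the copy at the
      common prefix, then appends the tail of \<open>w'\<close>.\<close>
    have "\<rho> w w' \<le> \<rho> w ?v + (\<rho> ?v ?v' + \<rho> ?v' w')"
      using tri[OF w(1) v(1) w(2)] tri[OF v w(2)] by simp
    also have "\<dots> \<le> \<eta> * j + (\<eta> * i + \<eta> * k)"
      using from_tail[OF v(1) s(5) ijk(2)] letter[OF words(1) s(3) ijk(1)]
        to_tail[OF v(2) s(6) ijk(3)] s(1,2) sym[of w ?v] by simp
    also have "\<dots> = \<eta> * real (i + j + k)" by (simp add: algebra_simps)
    also have "\<dots> \<le> \<eta> * m" using ijk(4) \<eta> by (intro mult_left_mono) auto
    finally show ?thesis .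
  qed
qed

section \<open>Gluing a measure on one copy to a measure on words\<close>

text \<open>Place \<open>p\<close> on the copy of \<open>X\<close> at \<open>v\<close>, with its mass at the basepoint redistributed
  according to \<open>\<mu>\<close>.\<close>

definition glue :: "'a \<Rightarrow> 'a list \<Rightarrow> ('a \<Rightarrow> real) \<Rightarrow> ('a list \<Rightarrow> real) \<Rightarrow> 'a list \<Rightarrow> real" where
  "glue x0 v p \<mu> z = (if z \<noteq> [] \<and> butlast z = v then p (last z) else 0) + p x0 * \<mu> z"

text \<open>The letters other than x0 contribute \<open>s - p x0\<close>, and \<mu> restores the
  missing \<open>p x0\<close>. The total \<open>s\<close> is arbitrary so that differences of
  measures can be glued too.\<close>

lemma has_sum_glue:
  assumes x0: "x0 \<in> X" and v: "v \<in> words X x0" and p: "(p has_sum s) X"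
    and \<mu>: "(\<mu> has_sum 1) (words X x0)"
  shows "(glue x0 v p \<mu> has_sum s) (words X x0)"
proof -
  \<comment> \<open>Cancelling the value at x0 allows the sum to be restricted to the genuine
    letters.\<close>
  have "((\<lambda>y. p y + - p x0 * of_bool (y = x0)) has_sum s + - p x0 * 1) X"
    using p prob_on_point[OF x0] by (intro has_sum_add has_sum_cmult_right) (auto simp: prob_on_def)
  then have "(p has_sum s - p x0) (X - {x0})"
    by (subst has_sum_cong_neutral[where T = X and g = "\<lambda>y. p y + - p x0 * of_bool (y = x0)"]) auto
  then have "((\<lambda>z. p (last z)) has_sum s - p x0) ((\<lambda>y. v @ [y]) ` (X - {x0}))"
    by (subst has_sum_reindex) (auto simp: inj_on_def o_def)
  then have "((\<lambda>z. if z \<noteq> [] \<and> butlast z = v then p (last z) else 0) has_sum s - p x0) (words X x0)"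
  proof (subst has_sum_cong_neutral[where T = "(\<lambda>y. v @ [y]) ` (X - {x0})" and g = "\<lambda>z. p (last z)"])
    fix z assume z: "z \<in> words X x0 - (\<lambda>y. v @ [y]) ` (X - {x0})"
    then have "z \<in> (\<lambda>y. v @ [y]) ` (X - {x0})" if "z \<noteq> []" "butlast z = v"
      using that last_in_words[of z X x0] by (intro image_eqI[of _ _ "last z"]) auto
    then show "(if z \<noteq> [] \<and> butlast z = v then p (last z) else 0) = 0"
      using z by auto
  qed (use v in auto)
  then have "((\<lambda>z. (if z \<noteq> [] \<and> butlast z = v then p (last z) else 0) + p x0 * \<mu> z)
      has_sum (s - p x0) + p x0 * 1) (words X x0)"
    using \<mu> by (intro has_sum_add has_sum_cmult_right)
  then show ?thesis by (simp add: glue_def[abs_def])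
qed

lemma prob_on_glue:
  assumes "x0 \<in> X" "v \<in> words X x0" "prob_on X p" "prob_on (words X x0) \<mu>"
  shows "prob_on (words X x0) (glue x0 v p \<mu>)"
proof -
  have "0 \<le> glue x0 v p \<mu> z" if "z \<in> words X x0" for z
    using assms that by (auto simp: glue_def prob_on_def last_in_words)
  then show ?thesis using assms has_sum_glue by (auto simp: prob_on_def)
qed

text \<open>The difference is dominated by the gluing of |p - q| with the same \<mu>, whose total
  \<open>has_sum_glue\<close> computes.\<close>

lemma l1_norm_glue_diff:
  assumes "x0 \<in> X" "v \<in> words X x0" "prob_on X p" "prob_on X q" "prob_on (words X x0) \<mu>"
  shows "l1_norm (words X x0) (\<lambda>z. glue x0 v p \<mu> z - glue x0 v q \<mu> z)
    \<le> l1_norm X (\<lambda>y. p y - q y)"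
proof (rule l1_norm_le)
  show "(glue x0 v (\<lambda>y. \<bar>p y - q y\<bar>) \<mu> has_sum l1_norm X (\<lambda>y. p y - q y)) (words X x0)"
    using assms by (intro has_sum_glue prob_on_diff_has_sum) (auto simp: prob_on_def)
  fix z assume "z \<in> words X x0"
  then have "0 \<le> \<mu> z" using assms by (auto simp: prob_on_def)
  then have "\<bar>p x0 * \<mu> z - q x0 * \<mu> z\<bar> = \<bar>p x0 - q x0\<bar> * \<mu> z"
    by (simp add: abs_mult flip: left_diff_distrib)
  then show "\<bar>glue x0 v p \<mu> z - glue x0 v q \<mu> z\<bar> \<le> glue x0 v (\<lambda>y. \<bar>p y - q y\<bar>) \<mu> z"
    by (auto simp: glue_def)
qed

text \<open>No word ends in x0, so \<open>p (last z)\<close> vanishes and all mass passes to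
  \<mu>.\<close>

lemma glue_point:
  assumes "\<And>y. p y = of_bool (y = x0)" "z \<in> words X x0" shows "glue x0 v p \<mu> z = \<mu> z"
  using assms by (auto simp: glue_def last_in_words)

section \<open>Retreat measures, their supports and their averages\<close>

fun retreat :: "'a \<Rightarrow> ('a \<Rightarrow> 'a \<Rightarrow> real) \<Rightarrow> nat \<Rightarrow> 'a list \<Rightarrow> 'a list \<Rightarrow> real" where
  "retreat x0 a 0 w = (\<lambda>z. of_bool (z = w))"
| "retreat x0 a (Suc n) w = (if w = [] then (\<lambda>z. of_bool (z = []))
     else glue x0 (butlast w) (a (last w)) (retreat x0 a n (butlast w)))"

lemma prob_on_retreat:
  assumes "x0 \<in> X" "\<And>x. x \<in> X \<Longrightarrow> prob_on X (a x)" "w \<in> words X x0"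
  shows "prob_on (words X x0) (retreat x0 a n w)"
  using assms(3)
proof (induction n arbitrary: w)
  case 0
  then show ?case by (simp add: prob_on_point)
next
  case (Suc n)
  from Suc.prems show ?case
    by (cases rule: words_snoc_cases) (use Suc.IH assms in \<open>auto intro: prob_on_glue prob_on_point\<close>)
qed

text \<open>Each round costs at most one \<open>K\<close>-step: either the mass settles in the
  current copy, or it moves to the basepoint and continues. Symmetry of \<open>K\<close> supplies
  the triangle inequality that adds these steps.\<close>

lemma retreat_support:
  assumes "K\<inverse> = K" and x0: "x0 \<in> X"
    and supp: "\<And>x y. x \<in> X \<Longrightarrow> y \<in> X \<Longrightarrow> a x y \<noteq> 0 \<Longrightarrow> (x, y) \<in> K"
    and "w \<in> words X x0" "z \<in> words X x0" "retreat x0 a n w z \<noteq> 0"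
  shows "word_dist x0 K w z \<le> enat n"
  using assms(4-)
proof (induction n arbitrary: w)
  case 0
  then show ?case by (auto simp: zero_enat_def split: if_splits)
next
  case (Suc n)
  from Suc.prems(1) show ?case
  proof (cases rule: words_snoc_cases)
    case 1
    then show ?thesis using Suc.prems by (auto simp: zero_enat_def split: if_splits)
  next
    case (2 v b)
    \<comment> \<open>Used with y = \<open>last z\<close> when mass settles, and with y = x0, where
      the target is \<open>v\<close>, when it continues.\<close>
    have near: "word_dist x0 K w (snoc_letter x0 v y) \<le> 1" if "y \<in> X" "a b y \<noteq> 0" for y
    proof -
      have "(b, y) \<in> ent_pow K 1" using supp 2 that by (simp add: ent_pow_def)
      then have "ent_dist K b y \<le> 1" using ent_dist_le by (metis one_enat_def)
      then show ?thesis
        using word_dist_snoc_letter_le[of x0 K v b y] 2 by (auto simp: snoc_letter_def intro: order_trans)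
    qed
    have "glue x0 v (a b) (retreat x0 a n v) z \<noteq> 0" using Suc.prems 2 by simp
    then have "z \<noteq> [] \<and> butlast z = v \<and> a b (last z) \<noteq> 0 \<or> a b x0 \<noteq> 0 \<and> retreat x0 a n v z \<noteq> 0"
      by (auto simp: glue_def split: if_splits)
    then consider "z \<noteq> []" "butlast z = v" "a b (last z) \<noteq> 0" | "a b x0 \<noteq> 0" "retreat x0 a n v z \<noteq> 0"
      by blast
    then show ?thesis
    proof cases
      case 1
      with Suc.prems(2) have "last z \<in> X" "z = snoc_letter x0 v (last z)"
        by (auto simp: snoc_letter_def last_in_words)
      then have "word_dist x0 K w z \<le> 1" using near 1 by metis
      also have "1 \<le> enat (Suc n)" by (simp add: one_enat_def)
      finally show ?thesis .
    next
      case c: 2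
      have "word_dist x0 K w z \<le> word_dist x0 K w v + word_dist x0 K v z"
        by (rule word_dist_triangle[OF assms(1)])
      also have "\<dots> \<le> 1 + enat n"
        using near[OF x0 c(1)] Suc.IH[OF 2(2) Suc.prems(2) c(2)] by (intro add_mono) auto
      finally show ?thesis by (simp add: one_enat_def)
    qed
  qed
qed

text \<open>The counters run from 1 to N: every term makes a first round, so at
  \<open>v @ [b]\<close> the mean is exactly an average of gluings over the retreats from
  \<open>v\<close> with counters 0 to N - 1.\<close>

definition mean_retreat :: "'a \<Rightarrow> ('a \<Rightarrow> 'a \<Rightarrow> real) \<Rightarrow> nat \<Rightarrow> 'a list \<Rightarrow> 'a list \<Rightarrow> real" where
  "mean_retreat x0 a N w z = (\<Sum>n<N. retreat x0 a (Suc n) w z) / N"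

lemma prob_on_mean_retreat:
  assumes "x0 \<in> X" "\<And>x. x \<in> X \<Longrightarrow> prob_on X (a x)" "w \<in> words X x0" "N > 0"
  shows "prob_on (words X x0) (mean_retreat x0 a N w)"
  unfolding mean_retreat_def[abs_def]
  using assms by (intro prob_on_average prob_on_retreat)

text \<open>The index shift between \<open>retreat\<close> at \<open>v @ [b]\<close> and at \<open>v\<close> telescopes in the average, which
  is thereby close to an average of measures depending on \<open>b\<close> only through \<open>a b\<close>.\<close>

lemma mean_retreat_near_glue:
  assumes x0: "x0 \<in> X" and a: "\<And>x. x \<in> X \<Longrightarrow> prob_on X (a x)"
    and a0: "\<And>y. a x0 y = of_bool (y = x0)"
    and v: "v \<in> words X x0" and b: "b \<in> X" and N: "N > 0"
  shows "l1_norm (words X x0) (\<lambda>z. mean_retreat x0 a N (snoc_letter x0 v b) z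
    - (\<Sum>n<N. glue x0 v (a b) (retreat x0 a n v) z) / N) \<le> 2 / N"
proof (rule l1_norm_le)
  \<comment> \<open>The majorant consists of the two end terms of the telescoping sum, each of mass
    1.\<close>
  have "((\<lambda>z. (1 / N) * (retreat x0 a N v z + retreat x0 a 0 v z)) has_sum (1 / N) * (1 + 1))
      (words X x0)"
    using prob_on_retreat[where a = a, OF x0 a v, of N] prob_on_retreat[where a = a, OF x0 a v, of 0]
    by (intro has_sum_add has_sum_cmult_right) (auto simp: prob_on_def)
  then show "((\<lambda>z. (1 / N) * (retreat x0 a N v z + retreat x0 a 0 v z)) has_sum 2 / N) (words X x0)"
    by simp
  fix z assume z: "z \<in> words X x0"
  have nonneg: "0 \<le> retreat x0 a n v z" for n
    using prob_on_retreat[where a = a, OF x0 a v] z by (auto simp: prob_on_def)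
  show "\<bar>mean_retreat x0 a N (snoc_letter x0 v b) z
    - (\<Sum>n<N. glue x0 v (a b) (retreat x0 a n v) z) / N\<bar>
    \<le> (1 / N) * (retreat x0 a N v z + retreat x0 a 0 v z)"
  proof (cases "b = x0")
    case True
    \<comment> \<open>For b = x0 each gluing reduces to \<open>retreat x0 a n v\<close>, leaving a
      sum of consecutive differences; for other letters the two averages coincide.\<close>
    have "mean_retreat x0 a N v z - (\<Sum>n<N. retreat x0 a n v z) / N
        = (retreat x0 a N v z - retreat x0 a 0 v z) / N"
      unfolding mean_retreat_def diff_divide_distrib[symmetric] sum_subtractf[symmetric]
      by (simp only: sum_lessThan_telescope[of "\<lambda>n. retreat x0 a n v z"])
    moreover have "\<bar>(p - q) / N\<bar> \<le> (1 / N) * (p + q)" if "0 \<le> p" "0 \<le> q" for p q :: real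
      using that N by (simp add: divide_right_mono)
    ultimately show ?thesis
      using True glue_point[OF a0 z] nonneg[of N] nonneg[of 0] by (simp del: retreat.simps)
  next
    case False
    then show ?thesis
      using nonneg[of N] nonneg[of 0] by (simp add: mean_retreat_def snoc_letter_def)
  qed
qed

text \<open>Both means lie within 2/N of averages of gluings with identical continuations. Those
  differ only through \<open>a b\<close> and \<open>a c\<close>, contributing \<delta>.\<close>

lemma mean_retreat_variation:
  assumes x0: "x0 \<in> X" and a: "\<And>x. x \<in> X \<Longrightarrow> prob_on X (a x)"
    and a0: "\<And>y. a x0 y = of_bool (y = x0)"
    and v: "v \<in> words X x0" and b: "b \<in> X" "c \<in> X" and N: "N > 0"
    and le: "l1_norm X (\<lambda>y. a b y - a c y) \<le> \<delta>"
  shows "l1_norm (words X x0) (\<lambda>z. mean_retreat x0 a N (snoc_letter x0 v b) z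
    - mean_retreat x0 a N (snoc_letter x0 v c) z) \<le> \<delta> + 4 / N"
proof -
  let ?W = "words X x0"
  let ?m = "\<lambda>b. mean_retreat x0 a N (snoc_letter x0 v b)"
  let ?g = "\<lambda>b z. (\<Sum>n<N. glue x0 v (a b) (retreat x0 a n v) z) / N"
  have m: "prob_on ?W (?m b)" if "b \<in> X" for b
    using that x0 a v N by (intro prob_on_mean_retreat snoc_letter_in_words)
  have gl: "prob_on ?W (glue x0 v (a b) (retreat x0 a n v))" if "b \<in> X" for b n
    using that x0 a v by (intro prob_on_glue prob_on_retreat)
  have g: "prob_on ?W (?g b)" if "b \<in> X" for b
    using that gl N by (intro prob_on_average)
  let ?d = "\<lambda>n z. \<bar>glue x0 v (a b) (retreat x0 a n v) z - glue x0 v (a c) (retreat x0 a n v) z\<bar>"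
  have "l1_norm ?W (\<lambda>z. ?g b z - ?g c z) \<le> \<delta>"
  proof -
    define s where "s n = l1_norm ?W (\<lambda>z. glue x0 v (a b) (retreat x0 a n v) z
      - glue x0 v (a c) (retreat x0 a n v) z)" for n
    have s: "s n \<le> \<delta>" for n
      unfolding s_def using l1_norm_glue_diff[of x0 X v "a b" "a c" "retreat x0 a n v"]
        prob_on_retreat[where a = a, OF x0 a v] x0 v a b le by (meson order_trans)
    have "((\<lambda>z. \<Sum>n<k. ?d n z) has_sum (\<Sum>n<k. s n)) ?W" for k
      unfolding s_def using gl b
      by (induction k) (auto intro!: has_sum_add prob_on_diff_has_sum)
    then have "((\<lambda>z. (1 / N) * (\<Sum>n<N. ?d n z)) has_sum (1 / N) * (\<Sum>n<N. s n)) ?W"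
      by (rule has_sum_cmult_right)
    moreover have "\<bar>?g b z - ?g c z\<bar> \<le> (1 / N) * (\<Sum>n<N. ?d n z)" for z
      using N by (simp add: divide_right_mono sum_abs flip: diff_divide_distrib sum_subtractf)
    ultimately have "l1_norm ?W (\<lambda>z. ?g b z - ?g c z) \<le> (1 / N) * (\<Sum>n<N. s n)"
      by (rule l1_norm_le)
    also have "\<dots> \<le> \<delta>"
      using sum_bounded_above[of "{..<N}" s \<delta>] s N by (simp add: field_simps)
    finally show ?thesis .
  qed
  moreover have "l1_norm ?W (\<lambda>z. ?m b z - ?g b z) \<le> 2 / N" if "b \<in> X" for b
    using x0 a a0 v that N by (rule mean_retreat_near_glue)
  note this[OF b(1)] this[OF b(2)]
  moreover note l1_norm_prob_on_triangle[OF m[OF b(1)] g[OF b(1)] m[OF b(2)]]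
    l1_norm_prob_on_triangle[OF g[OF b(1)] g[OF b(2)] m[OF b(2)]]
    l1_norm_diff_commute[of ?W "?g c" "?m c"]
  ultimately show ?thesis by linarith
qed

section \<open>Coarse property A of the free product\<close>

theorem corollary4p5:
  fixes X :: "'a set" and \<E> :: "('a \<times> 'a) set set" and x0 :: 'a
  assumes "coarse_space X \<E>"
    and "coarse_property_A X \<E>"
    and "x0 \<in> X"
  shows "coarse_property_A (words X x0) (free_coarse X x0 \<E>)"
  unfolding coarse_property_A_def
proof (intro allI impI ballI)
  interpret coarse_space X \<E> by fact
  let ?W = "words X x0"
  fix \<epsilon> :: real and S assume \<epsilon>: "\<epsilon> > 0" and "S \<in> free_coarse X x0 \<E>"
  then obtain E m where E: "E \<in> \<E>" and S: "S \<subseteq> word_ent X x0 E m"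
    by (auto simp: free_coarse_def)
  \<comment> \<open>The denominator m + 1 makes \<open>\<eta> * m < \<epsilon>\<close> strict and
    also covers m = 0.\<close>
  define \<eta> where "\<eta> = \<epsilon> / (m + 1)"
  have \<eta>: "\<eta> > 0" "\<eta> * m < \<epsilon>" using \<epsilon> by (auto simp: \<eta>_def field_simps)
  obtain K a where K: "K \<in> \<E>" "K\<inverse> = K" and a: "\<And>x. x \<in> X \<Longrightarrow> prob_on X (a x)"
    and a0: "\<And>y. a x0 y = of_bool (y = x0)"
    and supp: "\<And>x y. x \<in> X \<Longrightarrow> y \<in> X \<Longrightarrow> a x y \<noteq> 0 \<Longrightarrow> (x, y) \<in> K"
    and var: "\<And>x y. (x, y) \<in> E \<Longrightarrow> l1_norm X (\<lambda>z. a x z - a y z) < \<eta> / 2"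
    by (rule property_A_based[OF assms half_gt_zero[OF \<eta>(1)] E]) blast
  \<comment> \<open>One step costs at most \<eta>/2 from \<open>a\<close> and 4/N from averaging;
    this N keeps the sum below \<eta>.\<close>
  obtain N :: nat where N: "8 / \<eta> < N" using reals_Archimedean2 by blast
  have "0 < 8 / \<eta>" using \<eta> by simp
  with N have N0: "N > 0" by (auto intro!: Nat.gr0I)
  then have N: "4 / N \<le> \<eta> / 2" using N \<eta> by (simp add: field_simps)
  define A where "A = mean_retreat x0 a N"
  have A: "prob_on ?W (A w)" if "w \<in> ?W" for w
    unfolding A_def using prob_on_mean_retreat[where a = a, OF assms(3) a that N0] .
  have close: "l1_norm ?W (\<lambda>z. A w z - A w' z) < \<epsilon>" if "(w, w') \<in> S" for w w'
  proof -
    have w: "w \<in> ?W" "w' \<in> ?W" "word_dist x0 E w w' \<le> enat m"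
      using S that by (auto simp: word_ent_def)
    have "l1_norm ?W (\<lambda>z. A w z - A w' z) \<le> \<eta> * m"
    proof (rule word_dist_bounds_pseudometric[where \<rho> = "\<lambda>u v. l1_norm ?W (\<lambda>z. A u z - A v z)",
          OF assms(3) subset_carrier[OF E]])
      show "l1_norm ?W (\<lambda>z. A (snoc_letter x0 v b) z - A (snoc_letter x0 v c) z) \<le> \<eta>"
        if "v \<in> ?W" "(b, c) \<in> E" for v b c
      proof -
        have "b \<in> X" "c \<in> X" using subset_carrier[OF E] that by auto
        with mean_retreat_variation[where a = a, OF assms(3) a a0 that(1) _ _ N0 less_imp_le[OF var[OF that(2)]]]
        show ?thesis unfolding A_def using N by fastforce
      qed
      show "l1_norm ?W (\<lambda>z. A u z - A v z) = l1_norm ?W (\<lambda>z. A v z - A u z)" for u v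
        by (rule l1_norm_diff_commute)
      show "l1_norm ?W (\<lambda>z. A u z - A v z)
          \<le> l1_norm ?W (\<lambda>z. A u z - A x z) + l1_norm ?W (\<lambda>z. A x z - A v z)"
        if "u \<in> ?W" "x \<in> ?W" "v \<in> ?W" for u x v
        by (intro l1_norm_prob_on_triangle A that)
    qed (use w \<eta> in \<open>simp_all add: l1_norm_def\<close>)
    then show ?thesis using \<eta> by simp
  qed
  have word_dist_N: "word_dist x0 K w z \<le> enat N"
    if w: "w \<in> ?W" and z: "z \<in> ?W" and "A w z \<noteq> 0" for w z
  proof -
    have "(\<Sum>n<N. retreat x0 a (Suc n) w z) \<noteq> 0"
      using \<open>A w z \<noteq> 0\<close> unfolding A_def mean_retreat_def by (metis div_0)
    then obtain n where "n < N" "retreat x0 a (Suc n) w z \<noteq> 0"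
      by (rule sum.not_neutral_contains_not_neutral) blast
    then have "word_dist x0 K w z \<le> enat (Suc n)"
      using retreat_support[where a = a, OF K(2) assms(3) supp w z] by blast
    also have "\<dots> \<le> enat N" using \<open>n < N\<close> by simp
    finally show ?thesis .
  qed
  show "\<exists>K\<in>free_coarse X x0 \<E>. \<exists>a.
      (\<forall>w\<in>?W. a w \<in> l1 ?W \<and> (\<forall>z\<in>?W. 0 \<le> a w z) \<and> l1_norm ?W (a w) = 1) \<and>
      (\<forall>w\<in>?W. \<forall>z\<in>?W. a w z \<noteq> 0 \<longrightarrow> (w, z) \<in> K) \<and>
      (\<forall>(w, w')\<in>S. l1_norm ?W (\<lambda>z. a w z - a w' z) < \<epsilon>)"
  proof (intro bexI exI[of _ A] conjI)
    show "word_ent X x0 K N \<in> free_coarse X x0 \<E>" using K by (auto simp: free_coarse_def)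
    show "\<forall>w\<in>?W. A w \<in> l1 ?W \<and> (\<forall>z\<in>?W. 0 \<le> A w z) \<and> l1_norm ?W (A w) = 1"
      using A by (simp add: prob_on_iff_l1)
    show "\<forall>w\<in>?W. \<forall>z\<in>?W. A w z \<noteq> 0 \<longrightarrow> (w, z) \<in> word_ent X x0 K N"
      using word_dist_N by (auto simp: word_ent_def)
    show "\<forall>(w, w')\<in>S. l1_norm ?W (\<lambda>z. A w z - A w' z) < \<epsilon>" using close by auto
  qed
qed

end
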